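(* Let $G$ be a finite simple cubic graph and $\Pi$ a polyhedral embedding of $G$ with extended graph $G^e=G^e(\Pi)$. Suppose that for every scaffold edge $[t\,t']$ of $G^e$ there is a unique path of length three in $G$ with ends $t$ and $t'$. Then $G^e$ uniquely determines the facial cycle system: every polyhedral embedding $\Pi'$ of $G$ with $G^e(\Pi')=G^e$ has exactly the same set of facial cycles as $\Pi$.
   Context: An embedding of a graph in a surface without boundary is polyhedral if every facial walk (boundary walk of a face) is a cycle and any two distinct facial cycles intersect in either the empty set, a single vertex, or a single edge. A $\Pi$-facial subwalk is a walk formed by consecutive vertices of some $\Pi$-facial cycle. The extended graph $G^e(\Pi)$ has vertex set $V(G)$ and edge set $E(G)$ together with a multiset $\mathcal S$ of scaffold edges: for distinct vertices $t_0,t_3$, the scaffold edge $[t_0t_3]$ appears with multiplicity equal to the number of paths $(t_0t_1t_2t_3)$ of $G$ that are $\Pi$-facial subwalks. $G^e(\Pi')=G^e(\Pi)$ means the scaffold multisets coincide. *)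

theory Defs
  imports
    "Graph_Theory.Pair_Digraph"
    "HOL-Combinatorics.Orbits"
    "HOL-Library.Multiset"
    "HOL-Library.Sublist"
begin

text \<open>
  Finite simple graphs are \<^locale>\<open>pair_graph\<close>s: an undirected edge \<open>uv\<close> is a pair of
  opposite arcs \<open>(u, v)\<close>, \<open>(v, u)\<close>. Walks are lists of arcs.
\<close>

definition cubic :: "'a pair_pre_digraph \<Rightarrow> bool" where
  "cubic G \<longleftrightarrow> (\<forall>v\<in>pverts G. out_degree G v = 3)"

definition neighbours :: "'a pair_pre_digraph \<Rightarrow> 'a \<Rightarrow> 'a set" where
  "neighbours G v = {w. (v, w) \<in> parcs G}"

definition edges_of :: "('a \<times> 'a) list \<Rightarrow> 'a set set" where
  "edges_of p = (\<lambda>(u, v). {u, v}) ` set p"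

text \<open>
  An embedding in a surface without boundary, orientable or not, is given by its embedding scheme:
  the cyclic order of the neighbours around every vertex (with respect to a chosen local
  orientation), together with the edges along which the two local orientations disagree
  (signature \<open>-1\<close>). Values of \<open>twisted\<close> on sets that are not edges are irrelevant.
\<close>

record 'a embedding =
  rotation :: "'a \<Rightarrow> 'a \<Rightarrow> 'a"
  twisted :: "'a set \<Rightarrow> bool"

definition embedding_of :: "'a pair_pre_digraph \<Rightarrow> 'a embedding \<Rightarrow> bool" where
  "embedding_of G \<Phi> \<longleftrightarrow> (\<forall>v\<in>pverts G. rotation \<Phi> v permutes neighbours G v \<and>
     (neighbours G v \<noteq> {} \<longrightarrow> cyclic_on (rotation \<Phi> v) (neighbours G v)))"

text \<open>
  Face traversal. A state \<open>((u, v), b)\<close> says that the arc from \<open>u\<close> to \<open>v\<close> is about to be traversed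
  while the local orientation at \<open>u\<close> is followed (\<open>b\<close>) or opposed (\<open>\<not> b\<close>). A twisted edge changes
  the mode; at \<open>v\<close> one continues with the next or the previous edge in the rotation accordingly.
\<close>

fun face_step :: "'a embedding \<Rightarrow> ('a \<times> 'a) \<times> bool \<Rightarrow> ('a \<times> 'a) \<times> bool" where
  "face_step \<Phi> ((u, v), b) =
     (let b' = (b \<noteq> twisted \<Phi> {u, v})
      in ((v, if b' then rotation \<Phi> v u else inv (rotation \<Phi> v) u), b'))"

text \<open>
  Traversing an arc backwards along the same face; \<open>face_step\<close> undoes itself under this reversal.
\<close>

fun reverse_state :: "'a embedding \<Rightarrow> ('a \<times> 'a) \<times> bool \<Rightarrow> ('a \<times> 'a) \<times> bool" where
  "reverse_state \<Phi> ((u, v), b) = ((v, u), b = twisted \<Phi> {u, v})"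

lemma face_step_reverse_state:
  assumes "pair_graph G" "embedding_of G \<Phi>" "(u, v) \<in> parcs G"
  shows "face_step \<Phi> (reverse_state \<Phi> (face_step \<Phi> ((u, v), b))) = reverse_state \<Phi> ((u, v), b)"
proof -
  interpret pair_graph G by fact
  have "v \<in> pverts G"
    using assms(3) by (rule in_arcsD2)
  then have p: "rotation \<Phi> v permutes neighbours G v"
    using assms(2) by (simp add: embedding_of_def)
  show ?thesis
    by (auto simp: Let_def insert_commute permutes_inverses[OF p])
qed

text \<open>
  The closed walk traced out from a state until that very state (arc and mode) recurs.
  Every face is traced once for each starting arc and each of the two directions.
\<close>

definition facial_walk :: "'a embedding \<Rightarrow> ('a \<times> 'a) \<times> bool \<Rightarrow> ('a \<times> 'a) list" where
  "facial_walk \<Phi> s = map (\<lambda>i. fst ((face_step \<Phi> ^^ i) s)) [0..<funpow_dist1 (face_step \<Phi>) s s]"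

text \<open>
  Facial cycles as undirected cycles, given by their edge sets; \<open>\<Union>C\<close> is the vertex set of \<open>C\<close>.
\<close>

definition facial_cycles :: "'a pair_pre_digraph \<Rightarrow> 'a embedding \<Rightarrow> 'a set set set" where
  "facial_cycles G \<Phi> = {edges_of (facial_walk \<Phi> (a, b)) | a b. a \<in> parcs G}"

text \<open>
  The library's \<open>cycle\<close> admits the walk \<open>u v u\<close> along both arcs of one edge, hence the bound on
  the length. Two cycles with at most one common vertex have no common edge.
\<close>

definition polyhedral :: "'a pair_pre_digraph \<Rightarrow> 'a embedding \<Rightarrow> bool" where
  "polyhedral G \<Phi> \<longleftrightarrow> embedding_of G \<Phi> \<and>
     (\<forall>a\<in>parcs G. \<forall>b. pre_digraph.cycle G (facial_walk \<Phi> (a, b)) \<and>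
        3 \<le> length (facial_walk \<Phi> (a, b))) \<and>
     (\<forall>C\<in>facial_cycles G \<Phi>. \<forall>D\<in>facial_cycles G \<Phi>. C \<noteq> D \<longrightarrow>
        \<Union>C \<inter> \<Union>D = {} \<or>
        (\<exists>v. \<Union>C \<inter> \<Union>D = {v}) \<or>
        (\<exists>u v. \<Union>C \<inter> \<Union>D = {u, v} \<and> C \<inter> D = {{u, v}}))"

text \<open>
  Since all starting arcs and both directions of traversal occur among the facial walks,
  initial segments suffice.
\<close>

definition facial_subwalk :: "'a pair_pre_digraph \<Rightarrow> 'a embedding \<Rightarrow> ('a \<times> 'a) list \<Rightarrow> bool" where
  "facial_subwalk G \<Phi> p \<longleftrightarrow> (\<exists>a\<in>parcs G. \<exists>b. prefix p (facial_walk \<Phi> (a, b)))"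

definition path3 :: "'a pair_pre_digraph \<Rightarrow> 'a \<Rightarrow> ('a \<times> 'a) list \<Rightarrow> 'a \<Rightarrow> bool" where
  "path3 G t p t' \<longleftrightarrow> pre_digraph.apath G t p t' \<and> length p = 3"

record 'a extended_graph = "'a pair_pre_digraph" +
  scaffold :: "'a set multiset"

text \<open>
  A path and its reversal are the same undirected path and contribute a single scaffold edge;
  therefore paths are collected by their edge sets.
\<close>

definition extended_graph :: "'a pair_pre_digraph \<Rightarrow> 'a embedding \<Rightarrow> 'a extended_graph" where
  "extended_graph G \<Phi> =
     \<lparr>pverts = pverts G, parcs = parcs G,
      scaffold = image_mset fst (mset_set
        {({t, t'}, edges_of p) | t p t'. path3 G t p t' \<and> facial_subwalk G \<Phi> p})\<rparr>"

end

theory Submission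
  imports Defs
begin

text \<open>
  At a vertex of degree three every angle \<open>u v w\<close>, \<open>u \<noteq> w\<close>, lies on exactly one face, so traversal
  states correspond bijectively to angles. Uniqueness of the paths between the ends of scaffold
  edges recovers the facial paths of length three from the scaffold. They determine the
  continuation of every angle: it is prescribed by the facial path starting with that angle, and
  if there is none, then the face is a triangle. Hence the two embeddings have the same facial
  walks.
\<close>

section \<open>Rotations at vertices of degree three and traversal states\<close>

lemma cyclic_on_card_3_distinct:
  assumes "cyclic_on f S" "card S = 3" "u \<in> S"
  shows "f u \<noteq> u" "f (f u) \<noteq> u"
proof -
  have S: "orbit f u = S"
    using assms by (metis orbit_cyclic_eq3)
  show "f (f u) \<noteq> u"
  proof
    assume eq: "f (f u) = u"
    have "x \<in> {u, f u}" if "x \<in> orbit f u" for x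
      using that by induction (auto simp: eq)
    then have "card S \<le> card {u, f u}"
      using S by (intro card_mono) auto
    also have "\<dots> \<le> 2"
      by (simp add: card_insert_if)
    finally show False
      using assms(2) by simp
  qed
  then show "f u \<noteq> u"
    by metis
qed

lemma out_degree_eq_card_neighbours: "out_degree (with_proj G) v = card (neighbours G v)"
proof -
  have "out_arcs (with_proj G) v = Pair v ` neighbours G v"
    by (auto simp: out_arcs_def neighbours_def)
  then show ?thesis
    by (simp add: out_degree_def card_image inj_on_def)
qed

lemma face_state_cases [case_names state]:
  obtains u v b where "s = ((u, v), b)"
  by (metis surj_pair)

lemma fst_face_step: "fst (fst (face_step \<Phi> s)) = snd (fst s)"
  by (cases s rule: face_state_cases) (simp add: Let_def)

text \<open>A state \<open>s\<close> on the arc from \<open>u\<close> to \<open>v\<close> is read as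
  the angle \<open>u\<close>, \<open>v\<close>, \<open>next_vertex \<Phi> s\<close>. This replaces
  the mode, which depends on the chosen local orientations, by data of the graph that two embeddings
  can share.\<close>

definition next_vertex :: "'a embedding \<Rightarrow> ('a \<times> 'a) \<times> bool \<Rightarrow> 'a" where
  "next_vertex \<Phi> s = snd (fst (face_step \<Phi> s))"

lemma fst_face_step_eq: "fst (face_step \<Phi> s) = (snd (fst s), next_vertex \<Phi> s)"
  by (simp add: next_vertex_def fst_face_step prod_eq_iff)

lemma fst_reverse_state: "fst (reverse_state \<Phi> s) = prod.swap (fst s)"
  by (cases s rule: face_state_cases) simp

section \<open>Paths of length three and the scaffold\<close>

lemma path3_iff:
  assumes "pair_graph G"
  shows "path3 G t p t' \<longleftrightarrow> (\<exists>u v. p = [(t, u), (u, v), (v, t')] \<and> distinct [t, u, v, t'] \<and> set p \<subseteq> parcs G)"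
proof -
  interpret pair_graph G by fact
  show ?thesis
    by (auto simp: path3_def apath_def awalk_def numeral_3_eq_3 length_Suc_conv dest: in_arcsD1)
qed

lemma set_scaffold:
  assumes "pair_graph G"
  shows "set_mset (scaffold (extended_graph G \<Phi>)) =
    {{t, t'} | t p t'. path3 G t p t' \<and> facial_subwalk G \<Phi> p}"
proof -
  interpret pair_graph G by fact
  \<comment> \<open>\<open>mset_set\<close> of an infinite set is empty by convention, so membership
    in the scaffold can be read off only once finiteness is known.\<close>
  have "finite {({t, t'}, edges_of p) | t p t'. path3 G t p t' \<and> facial_subwalk G \<Phi> p}"
  proof (rule finite_subset)
    show "{({t, t'}, edges_of p) | t p t'. path3 G t p t' \<and> facial_subwalk G \<Phi> p}
      \<subseteq> Pow (pverts G) \<times> Pow (Pow (pverts G))"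
      by (fastforce simp: path3_iff[OF assms] edges_of_def dest: in_arcsD1 in_arcsD2)
  qed simp
  then show ?thesis
    by (force simp: extended_graph_def)
qed

lemma prefix_facial_walk:
  assumes "3 \<le> length (facial_walk \<Phi> s)" "length p = 3"
  shows "prefix p (facial_walk \<Phi> s) \<longleftrightarrow>
    p = [fst s, fst (face_step \<Phi> s), fst (face_step \<Phi> (face_step \<Phi> s))]"
proof -
  have "[0..<3] = [0, 1, 2 :: nat]"
    by (simp add: numeral_3_eq_3 numeral_2_eq_2)
  then have "take 3 (facial_walk \<Phi> s) = [fst s, fst (face_step \<Phi> s), fst (face_step \<Phi> (face_step \<Phi> s))]"
    using assms(1) by (simp add: facial_walk_def take_map take_upt numeral_2_eq_2 del: upt_Suc)
  then show ?thesis
    using assms by (metis prefix_def append_eq_conv_conj take_is_prefix)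
qed

section \<open>Angles and facial paths of a single cubic embedding\<close>

locale cubic_embedding = pair_graph G for G :: "'a pair_pre_digraph" +
  fixes \<Phi> :: "'a embedding"
  assumes cubic: "cubic G" and embedding: "embedding_of G \<Phi>"
    and length_facial_walk: "a \<in> parcs G \<Longrightarrow> 3 \<le> length (facial_walk \<Phi> (a, b))"
begin

text \<open>The rotation at \<open>v\<close> is a 3-cycle, so it has no fixed point among the
  neighbours, and its square has none either; the latter separates the successor of \<open>u\<close>
  from its predecessor.\<close>

lemma
  assumes "v \<in> pverts G" "u \<in> neighbours G v"
  shows rotation_in: "rotation \<Phi> v u \<in> neighbours G v"
    and inv_rotation_in: "inv (rotation \<Phi> v) u \<in> neighbours G v"
    and rotation_neq: "rotation \<Phi> v u \<noteq> u"
    and inv_rotation_neq: "inv (rotation \<Phi> v) u \<noteq> u"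
    and rotation_neq_inv: "rotation \<Phi> v u \<noteq> inv (rotation \<Phi> v) u"
proof -
  have p: "rotation \<Phi> v permutes neighbours G v"
    and c: "cyclic_on (rotation \<Phi> v) (neighbours G v)"
    using assms embedding by (auto simp: embedding_of_def)
  have "card (neighbours G v) = 3"
    using cubic assms(1) by (simp add: cubic_def out_degree_eq_card_neighbours)
  note d = cyclic_on_card_3_distinct[OF c this assms(2)]
  show "rotation \<Phi> v u \<in> neighbours G v" "inv (rotation \<Phi> v) u \<in> neighbours G v"
    using assms(2) permutes_in_image[OF p] permutes_in_image[OF permutes_inv[OF p]] by auto
  show "rotation \<Phi> v u \<noteq> u" "inv (rotation \<Phi> v) u \<noteq> u"
    "rotation \<Phi> v u \<noteq> inv (rotation \<Phi> v) u"
    using d permutes_inverses[OF p] by metis+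
qed

lemma neighbour_of_head: "(u, v) \<in> parcs G \<Longrightarrow> v \<in> pverts G \<and> u \<in> neighbours G v"
  using arcs_symmetric[of u v] in_arcsD2[of u v] by (simp add: neighbours_def)

lemma face_step_in_arcs:
  assumes "fst s \<in> parcs G"
  shows "fst (face_step \<Phi> s) \<in> parcs G"
proof (cases s rule: face_state_cases)
  case (state u v b)
  then show ?thesis
    using assms neighbour_of_head[of u v] rotation_in[of v u] inv_rotation_in[of v u]
    by (auto simp: Let_def neighbours_def)
qed

lemma next_vertex_neq:
  assumes "fst s \<in> parcs G"
  shows "next_vertex \<Phi> s \<noteq> fst (fst s)"
proof (cases s rule: face_state_cases)
  case (state u v b)
  then show ?thesis
    using assms neighbour_of_head[of u v] rotation_neq[of v u] inv_rotation_neq[of v u]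
    by (auto simp: Let_def next_vertex_def)
qed

lemma next_vertex_in:
  assumes "fst s \<in> parcs G"
  shows "next_vertex \<Phi> s \<in> neighbours G (snd (fst s))"
  using face_step_in_arcs[OF assms] by (simp add: fst_face_step_eq neighbours_def)

text \<open>The two modes leave \<open>v\<close> by the successor and the predecessor of
  \<open>u\<close>, which differ at degree three. Hence an angle determines its traversal
  state.\<close>

lemma next_vertex_inj:
  assumes "fst s \<in> parcs G" "fst s' = fst s" "next_vertex \<Phi> s' = next_vertex \<Phi> s"
  shows "s' = s"
proof (cases s rule: face_state_cases)
  case (state u v b)
  obtain b' where s': "s' = ((u, v), b')"
    using assms(2) state by (metis fst_conv surj_pair)
  then show ?thesis
    using assms(1,3) state neighbour_of_head[of u v] rotation_neq_inv[of v u]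
    by (auto simp: Let_def next_vertex_def split: if_splits)
qed

text \<open>The two modes yield two distinct neighbours of \<open>v\<close> other than
  \<open>u\<close>, and at degree three there are no others. So every angle is traversed by some
  face.\<close>

lemma ex_next_vertex:
  assumes "(u, v) \<in> parcs G" "w \<in> neighbours G v" "w \<noteq> u"
  shows "\<exists>b. next_vertex \<Phi> ((u, v), b) = w"
proof -
  let ?n = "\<lambda>b. next_vertex \<Phi> ((u, v), b)"
  have neq: "?n True \<noteq> ?n False"
    using next_vertex_inj[of "((u, v), True)" "((u, v), False)"] assms(1) by auto
  have sub: "{u, ?n True, ?n False} \<subseteq> neighbours G v"
    using assms(1) neighbour_of_head next_vertex_in[of "((u, v), True)"]
      next_vertex_in[of "((u, v), False)"] by auto
  have card: "card (neighbours G v) = 3"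
    using cubic neighbour_of_head[OF assms(1)] by (simp add: cubic_def out_degree_eq_card_neighbours)
  moreover have "card {u, ?n True, ?n False} = 3"
    using neq next_vertex_neq[of "((u, v), True)"] next_vertex_neq[of "((u, v), False)"] assms(1)
    by auto
  ultimately have "{u, ?n True, ?n False} = neighbours G v"
    using sub by (intro card_subset_eq) (auto intro: card_ge_0_finite)
  then show ?thesis
    using assms(2,3) by auto
qed

lemma facial_subwalk_iff:
  assumes "length p = 3"
  shows "facial_subwalk G \<Phi> p \<longleftrightarrow>
    (\<exists>s. fst s \<in> parcs G \<and> p = [fst s, fst (face_step \<Phi> s), fst (face_step \<Phi> (face_step \<Phi> s))])"
  using prefix_facial_walk[OF length_facial_walk assms] unfolding facial_subwalk_def by (metis prod.collapse fst_conv)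

text \<open>Reversing the last of the three states and stepping from there retraces the same face
  backwards. This is needed because scaffold edges are unordered and do not record the direction of
  a path.\<close>

lemma facial_subwalk_reverse:
  assumes "length p = 3" "facial_subwalk G \<Phi> p"
  shows "facial_subwalk G \<Phi> (rev (map prod.swap p))"
proof -
  obtain s where s: "fst s \<in> parcs G"
    and p: "p = [fst s, fst (face_step \<Phi> s), fst (face_step \<Phi> (face_step \<Phi> s))]"
    using assms by (auto simp: facial_subwalk_iff)
  let ?r = "reverse_state \<Phi>" and ?f = "face_step \<Phi>"
  have rev: "?f (?r (?f s)) = ?r s" if "fst s \<in> parcs G" for s
    using that face_step_reverse_state[OF pair_graph embedding]
    by (cases s rule: face_state_cases) simp
  have arcs: "fst (?f s) \<in> parcs G" "fst (?f (?f s)) \<in> parcs G"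
    using s face_step_in_arcs by auto
  have "fst (?r (?f (?f s))) \<in> parcs G"
    using arcs(2) arcs_symmetric by (metis fst_reverse_state prod.collapse swap_simp)
  moreover have "rev (map prod.swap p) = [fst (?r (?f (?f s))), fst (?f (?r (?f (?f s)))),
      fst (?f (?f (?r (?f (?f s)))))]"
    using s arcs by (simp add: p rev fst_reverse_state)
  moreover have "length (rev (map prod.swap p)) = 3"
    using assms(1) by simp
  ultimately show ?thesis
    using facial_subwalk_iff by blast
qed

text \<open>The angle \<open>u\<close>, \<open>v\<close>, \<open>w\<close> belongs to the state
  \<open>s\<close> alone, so a facial path that starts with it must follow \<open>s\<close>. The
  case \<open>x = u\<close> is excluded because there the three arcs close up and form no
  path.\<close>

lemma facial_subwalk_path3_iff:
  assumes "distinct [u, v, w]" "(u, v) \<in> parcs G" "(v, w) \<in> parcs G" "fst s = (u, v)" "next_vertex \<Phi> s = w"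
    and "x \<noteq> u"
  shows "path3 G u [(u, v), (v, w), (w, x)] x \<and> facial_subwalk G \<Phi> [(u, v), (v, w), (w, x)] \<longleftrightarrow>
    next_vertex \<Phi> (face_step \<Phi> s) = x"
proof
  assume "path3 G u [(u, v), (v, w), (w, x)] x \<and> facial_subwalk G \<Phi> [(u, v), (v, w), (w, x)]"
  then obtain s' where s': "fst s' = (u, v)" "fst (face_step \<Phi> s') = (v, w)"
    "fst (face_step \<Phi> (face_step \<Phi> s')) = (w, x)"
    by (auto simp: facial_subwalk_iff)
  then have "s' = s"
    using assms by (intro next_vertex_inj) (auto simp: fst_face_step_eq)
  then show "next_vertex \<Phi> (face_step \<Phi> s) = x"
    using s' by (simp add: fst_face_step_eq)
next
  assume x: "next_vertex \<Phi> (face_step \<Phi> s) = x"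
  have arc: "fst (face_step \<Phi> s) \<in> parcs G" "fst (face_step \<Phi> (face_step \<Phi> s)) \<in> parcs G"
    using assms face_step_in_arcs by auto
  \<comment> \<open>The vertices of the path are distinct: a face does not turn back along an arc,
    there are no loops, and \<open>x\<close> differs from \<open>u\<close> by assumption.\<close>
  have "x \<noteq> v"
    using next_vertex_neq[OF arc(1)] assms x by (simp add: fst_face_step_eq)
  moreover have "x \<noteq> w"
    using arc(2) assms x no_loops[of "(w, x)"] by (auto simp: fst_face_step_eq)
  moreover have "[(u, v), (v, w), (w, x)] =
      [fst s, fst (face_step \<Phi> s), fst (face_step \<Phi> (face_step \<Phi> s))]"
    using assms x by (simp add: fst_face_step_eq)
  then have "facial_subwalk G \<Phi> [(u, v), (v, w), (w, x)]"
    using assms facial_subwalk_iff[of "[(u, v), (v, w), (w, x)]"] by (metis length_Cons list.size(3) numeral_3_eq_3)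
  ultimately show "path3 G u [(u, v), (v, w), (w, x)] x \<and> facial_subwalk G \<Phi> [(u, v), (v, w), (w, x)]"
    using assms x arc by (auto simp: path3_iff[OF pair_graph] fst_face_step_eq)
qed

end

section \<open>Two embeddings with the same facial paths of length three\<close>

locale two_cubic_embeddings = cubic_embedding G \<Phi> + other: cubic_embedding G \<Phi>'
  for G :: "'a pair_pre_digraph" and \<Phi> \<Phi>' :: "'a embedding" +
  assumes same_facial_paths: "path3 G t p t' \<Longrightarrow> facial_subwalk G \<Phi>' p \<longleftrightarrow> facial_subwalk G \<Phi> p"
begin

text \<open>The modes of \<open>s\<close> and \<open>s'\<close> are left unrelated, since the two
  embeddings may choose different local orientations.\<close>

definition same_angle :: "('a \<times> 'a) \<times> bool \<Rightarrow> ('a \<times> 'a) \<times> bool \<Rightarrow> bool" where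
  "same_angle s s' \<longleftrightarrow> fst s \<in> parcs G \<and> fst s' = fst s \<and> next_vertex \<Phi>' s' = next_vertex \<Phi> s"

lemma same_angle_face_step:
  assumes "same_angle s s'"
  shows "same_angle (face_step \<Phi> s) (face_step \<Phi>' s')"
proof -
  obtain u v w where s: "fst s = (u, v)" "fst s' = (u, v)" "(u, v) \<in> parcs G"
    "next_vertex \<Phi> s = w" "next_vertex \<Phi>' s' = w"
    using assms by (cases "fst s") (auto simp: same_angle_def)
  have vw: "(v, w) \<in> parcs G"
    using face_step_in_arcs[of s] s by (simp add: fst_face_step_eq)
  have "distinct [u, v, w]"
    using s vw next_vertex_neq[of s] no_loops[of "(u, v)"] no_loops[of "(v, w)"] by auto
  note iff = facial_subwalk_path3_iff[OF this s(3) vw s(1,4)]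
    other.facial_subwalk_path3_iff[OF this s(3) vw s(2,5)]
  \<comment> \<open>For \<open>x\<close> other than \<open>u\<close>, each side says that the path
    \<open>u\<close>, \<open>v\<close>, \<open>w\<close>, \<open>x\<close> is facial in the
    respective embedding.\<close>
  have "next_vertex \<Phi>' (face_step \<Phi>' s') = x \<longleftrightarrow> next_vertex \<Phi> (face_step \<Phi> s) = x"
    if "x \<noteq> u" for x
    unfolding iff(1)[OF that, symmetric] iff(2)[OF that, symmetric]
    using same_facial_paths by blast
  \<comment> \<open>If either continuation differs from \<open>u\<close>, the equivalence forces the
    other to agree; otherwise both are \<open>u\<close>.\<close>
  then have "next_vertex \<Phi>' (face_step \<Phi>' s') = next_vertex \<Phi> (face_step \<Phi> s)"
    by metis
  then show ?thesis
    using vw s by (simp add: same_angle_def fst_face_step_eq)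
qed

lemma same_angle_funpow:
  "same_angle s s' \<Longrightarrow> same_angle ((face_step \<Phi> ^^ n) s) ((face_step \<Phi>' ^^ n) s')"
  by (induction n) (simp_all add: same_angle_face_step del: face_step.simps)

lemma facial_walk_eq:
  assumes "same_angle s s'"
  shows "facial_walk \<Phi>' s' = facial_walk \<Phi> s"
proof -
  \<comment> \<open>The iterates keep matching angles, and within each embedding the angle
    determines the state, so both traversals return to their starting states simultaneously.\<close>
  have "(face_step \<Phi>' ^^ n) s' = s' \<longleftrightarrow> (face_step \<Phi> ^^ n) s = s" for n
    using assms same_angle_funpow[OF assms, of n]
      next_vertex_inj[of s "(face_step \<Phi> ^^ n) s"] other.next_vertex_inj[of s' "(face_step \<Phi>' ^^ n) s'"]
    unfolding same_angle_def by metis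
  \<comment> \<open>\<open>funpow_dist1\<close> searches for the first return from the successor of
    the start, hence the shift by one step.\<close>
  then have "(face_step \<Phi>' ^^ n) (face_step \<Phi>' s') = s' \<longleftrightarrow> (face_step \<Phi> ^^ n) (face_step \<Phi> s) = s" for n
    by (metis comp_apply funpow_Suc_right)
  then have "funpow_dist1 (face_step \<Phi>') s' s' = funpow_dist1 (face_step \<Phi>) s s"
    by (simp add: funpow_dist_def)
  then show ?thesis
    using same_angle_funpow[OF assms] by (simp add: facial_walk_def same_angle_def)
qed

lemma facial_cycles_subset: "facial_cycles G \<Phi> \<subseteq> facial_cycles G \<Phi>'"
proof
  fix C assume "C \<in> facial_cycles G \<Phi>"
  then obtain u v b where C: "C = edges_of (facial_walk \<Phi> ((u, v), b))" "(u, v) \<in> parcs G"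
    by (auto simp: facial_cycles_def)
  \<comment> \<open>The same angle may require another mode in \<open>\<Phi>'\<close>; a suitable
    one exists because the vertex has degree three.\<close>
  obtain b' where "next_vertex \<Phi>' ((u, v), b') = next_vertex \<Phi> ((u, v), b)"
    using other.ex_next_vertex[OF C(2)] next_vertex_in[of "((u, v), b)"]
      next_vertex_neq[of "((u, v), b)"] C(2) by auto
  then have "same_angle ((u, v), b) ((u, v), b')"
    using C(2) by (simp add: same_angle_def)
  then show "C \<in> facial_cycles G \<Phi>'"
    using C by (auto simp: facial_cycles_def facial_walk_eq[symmetric])
qed

end

section \<open>Recovering the facial paths from the scaffold\<close>

lemma cubic_embeddingI:
  "pair_graph G \<Longrightarrow> cubic G \<Longrightarrow> polyhedral G \<Phi> \<Longrightarrow> cubic_embedding G \<Phi>"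
  unfolding cubic_embedding_def cubic_embedding_axioms_def polyhedral_def by blast

lemma path3_reverse:
  assumes "pair_graph G" "path3 G t p t'"
  shows "path3 G t' (rev (map prod.swap p)) t"
proof -
  interpret pair_graph G by fact
  show ?thesis
    using assms(2) by (auto simp: path3_iff[OF assms(1)] intro: arcs_symmetric)
qed

text \<open>The scaffold edge of \<open>p\<close> also arises from a facial path \<open>q\<close> of
  \<open>\<Phi>'\<close> with the same pair of ends. Uniqueness then identifies \<open>p\<close>
  with \<open>q\<close> or with its reversal.\<close>

lemma facial_subwalk_if_same_scaffold:
  assumes "cubic_embedding G \<Phi>" "cubic_embedding G \<Phi>'"
    and scaffold: "scaffold (extended_graph G \<Phi>') = scaffold (extended_graph G \<Phi>)"
    and unique: "\<And>t t'. {t, t'} \<in># scaffold (extended_graph G \<Phi>) \<Longrightarrow> \<exists>!p. path3 G t p t'"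
    and p: "path3 G t p t'" "facial_subwalk G \<Phi> p"
  shows "facial_subwalk G \<Phi>' p"
proof -
  interpret cubic_embedding G \<Phi> by fact
  interpret other: cubic_embedding G \<Phi>' by fact
  have mem: "{t, t'} \<in># scaffold (extended_graph G \<Phi>)"
    using p by (auto simp: set_scaffold[OF pair_graph])
  then have "{t, t'} \<in># scaffold (extended_graph G \<Phi>')"
    by (simp add: scaffold)
  then obtain t1 q t1' where q: "path3 G t1 q t1'" "facial_subwalk G \<Phi>' q" "{t, t'} = {t1, t1'}"
    by (auto simp: set_scaffold[OF pair_graph])
  have "length q = 3"
    using q(1) by (simp add: path3_def)
  consider "t1 = t" "t1' = t'" | "t1 = t'" "t1' = t"
    using q(3) by (auto simp: doubleton_eq_iff)
  then show ?thesis
  proof cases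
    case 1
    then show ?thesis
      using unique[OF mem] p(1) q by blast
  next
    case 2
    then have "rev (map prod.swap q) = p"
      using unique[OF mem] p(1) path3_reverse[OF pair_graph q(1)] by blast
    then show ?thesis
      using other.facial_subwalk_reverse[OF \<open>length q = 3\<close> q(2)] by simp
  qed
qed

theorem theorem9:
  fixes G :: "'a pair_pre_digraph" and \<Phi> :: "'a embedding"
  assumes "pair_graph G" and "cubic G"
    and "polyhedral G \<Phi>"
    and "\<And>t t'. {t, t'} \<in># scaffold (extended_graph G \<Phi>) \<Longrightarrow> \<exists>!p. path3 G t p t'"
  shows "\<forall>\<Phi>'. polyhedral G \<Phi>' \<and> extended_graph G \<Phi>' = extended_graph G \<Phi> \<longrightarrow>
           facial_cycles G \<Phi>' = facial_cycles G \<Phi>"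
proof (intro allI impI)
  fix \<Phi>' assume \<Phi>': "polyhedral G \<Phi>' \<and> extended_graph G \<Phi>' = extended_graph G \<Phi>"
  have emb: "cubic_embedding G \<Phi>" "cubic_embedding G \<Phi>'"
    using cubic_embeddingI[OF assms(1,2)] assms(3) \<Phi>' by blast+
  have scaffold: "scaffold (extended_graph G \<Phi>') = scaffold (extended_graph G \<Phi>)"
    using \<Phi>' by simp
  \<comment> \<open>Equality of the scaffolds transfers the uniqueness hypothesis to
    \<open>\<Phi>'\<close>, so the argument applies in both directions.\<close>
  have "facial_subwalk G \<Phi>' p \<longleftrightarrow> facial_subwalk G \<Phi> p" if "path3 G t p t'" for t p t'
    using facial_subwalk_if_same_scaffold[OF emb scaffold assms(4) that]
      facial_subwalk_if_same_scaffold[OF emb(2,1) scaffold[symmetric] assms(4)[folded scaffold] that]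
    by blast
  then have "two_cubic_embeddings G \<Phi> \<Phi>'" "two_cubic_embeddings G \<Phi>' \<Phi>"
    using emb by (simp_all add: two_cubic_embeddings_def two_cubic_embeddings_axioms_def)
  then show "facial_cycles G \<Phi>' = facial_cycles G \<Phi>"
    using two_cubic_embeddings.facial_cycles_subset by blast
qed

end
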